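(* Let $\mathbb{C}$ be a Cartesian closed differential category with a parametrized fixpoint operator $\mathbf{fix}$, and for every object $X$ let $\mathcal{Y}_X:=\mathbf{fix}^X_{X\Rightarrow X}(\mathrm{eval}_{X,X}):(X\Rightarrow X)\to X$. Then: (i) $\mathbf{fix}$ satisfies the differential-fixpoint rule if and only if, for all objects $X$, $\mathbf{D}[\mathcal{Y}_X]=\pi_2\circ\mathcal{Y}_{\mathbf{T}X}\circ\lambda(\mathbf{T}(\mathrm{eval}_{X,X})\circ c)$; (ii) $\mathbf{fix}$ satisfies the tangent-fixpoint rule if and only if, for all objects $X$, $\mathbf{T}(\mathcal{Y}_X)=\mathcal{Y}_{\mathbf{T}X}\circ\lambda(\mathbf{T}(\mathrm{eval}_{X,X})\circ c)$; (iii) $\mathbf{fix}$ satisfies the strong differential-fixpoint rule if and only if, for all objects $X$, $\mathbf{D}[\mathcal{Y}_X]=\mathcal{Y}_X\circ\lambda\big(\mathbf{D}[\mathrm{eval}_{X,X}]\circ\langle\pi_1,\mathcal{Y}_X\circ\pi_1,\pi_2,\pi_3\rangle\big)$, where $\pi_1,\pi_2,\pi_3$ are the projections from $(X\Rightarrow X)\times(X\Rightarrow X)\times X$.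
   Context: A left additive category is a category whose hom-sets are commutative monoids $(+,0)$ with $(f+g)\circ x=f\circ x+g\circ x$ and $0\circ x=0$. A map $f$ is additive if $f\circ(x+y)=f\circ x+f\circ y$ and $f\circ 0=0$. A Cartesian left additive category is a left additive category with finite products (terminal object $\top$, projections $\pi_j$, pairing $\langle -,\dots,-\rangle$) in which all projections are additive. A Cartesian differential category is a Cartesian left additive category $\mathbb{C}$ with a differential combinator: functions $\mathbf{D}:\mathbb{C}(A,B)\to\mathbb{C}(A\times A,B)$ such that: [CD.1] $\mathbf{D}[0]=0$, $\mathbf{D}[f+g]=\mathbf{D}[f]+\mathbf{D}[g]$; [CD.2] $\mathbf{D}[f]\circ\langle x,0\rangle=0$, $\mathbf{D}[f]\circ\langle x,y+z\rangle=\mathbf{D}[f]\circ\langle x,y\rangle+\mathbf{D}[f]\circ\langle x,z\rangle$; [CD.3] $\mathbf{D}[1_A]=\pi_2$, $\mathbf{D}[\pi_j]=\pi_j\circ\pi_2$; [CD.4] $\mathbf{D}[\langle f_1,\dots,f_n\rangle]=\langle\mathbf{D}[f_1],\dots,\mathbf{D}[f_n]\rangle$; [CD.5] $\mathbf{D}[g\circ f]=\mathbf{D}[g]\circ\langle f\circ\pi_1,\mathbf{D}[f]\rangle$; [CD.6] $\mathbf{D}[\mathbf{D}[f]]\circ\langle x,y,0,z\rangle=\mathbf{D}[f]\circ\langle x,z\rangle$; [CD.7] $\mathbf{D}[\mathbf{D}[f]]\circ\langle x,y,z,0\rangle=\mathbf{D}[\mathbf{D}[f]]\circ\langle x,z,y,0\rangle$.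 The tangent bundle functor $\mathbf{T}:\mathbb{C}\to\mathbb{C}$ is $\mathbf{T}(A)=A\times A$, $\mathbf{T}(f)=\langle f\circ\pi_1,\mathbf{D}[f]\rangle$. Write $c=\langle\pi_1,\pi_3,\pi_2,\pi_4\rangle:A\times B\times C\times D\to A\times C\times B\times D$ for the isomorphism swapping the middle two factors. In a Cartesian closed category, $A\Rightarrow B$ is the internal hom, $\mathrm{eval}_{A,B}:(A\Rightarrow B)\times A\to B$ the evaluation, and for $f:C\times A\to B$ its currying $\lambda(f):C\to(A\Rightarrow B)$ is the unique map with $\mathrm{eval}_{A,B}\circ(\lambda(f)\times 1_A)=f$. A Cartesian closed differential category is a Cartesian differential category which is Cartesian closed and such that every evaluation map is linear in its first (internal hom) argument, i.e. $\mathbf{D}[\mathrm{eval}_{A,B}]\circ\langle g,a,h,0\rangle=\mathrm{eval}_{A,B}\circ\langle h,a\rangle$ for all $g,h:C\to(A\Rightarrow B)$, $a:C\to A$. A parametrized fixpoint operator on a category with finite products is a family of functions $\mathbf{fix}^X_A:\mathbb{C}(A\times X,X)\to\mathbb{C}(A,X)$ with (fixpoint axiom) $f\circ\langle 1_A,\mathbf{fix}^X_A(f)\rangle=\mathbf{fix}^X_A(f)$ for all $f:A\times X\to X$, and (naturality) $\mathbf{fix}^X_B(f)\circ g=\mathbf{fix}^X_A(f\circ(g\times 1_X))$ for all $g:A\to B$, $f:B\times X\to X$. The rules, each required for every $f:A\times X\to X$, are: differential-fixpoint rule: $\mathbf{D}[\mathbf{fix}^X_A(f)]=\pi_2\circ\mathbf{fix}^{\mathbf{T}X}_{\mathbf{T}A}(\mathbf{T}(f)\circ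 c)$; tangent-fixpoint rule: $\mathbf{T}(\mathbf{fix}^X_A(f))=\mathbf{fix}^{\mathbf{T}X}_{\mathbf{T}A}(\mathbf{T}(f)\circ c)$; strong differential-fixpoint rule: $\mathbf{D}[\mathbf{fix}^X_A(f)]=\mathbf{fix}^X_{A\times A}\big(\mathbf{D}[f]\circ\langle\pi_1,\mathbf{fix}^X_A(f)\circ\pi_1,\pi_2,\pi_3\rangle\big)$, with $\pi_1,\pi_2,\pi_3$ the projections from $A\times A\times X$. *)

theory Defs
  imports Main
begin

text \<open>
  Arrows carry their domain and codomain. Finite products are given by a chosen terminal object
  and chosen binary products; a longer product is a nested binary one, bracketed as the types
  demand. In particular, for \<open>f : A \<rightarrow> B\<close> the domain of \<open>D (D f)\<close> is
  \<open>(A \<times> A) \<times> (A \<times> A)\<close>, so a 4-tuple \<open>\<langle>x, y, z, w\<rangle>\<close> into it is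
  \<open>\<langle>\<langle>x, y\<rangle>, \<langle>z, w\<rangle>\<rangle>\<close>, and a ternary product \<open>A \<times> B \<times> E\<close> is \<open>(A \<times> B) \<times> E\<close>.
  Operations whose index objects cannot be read off from their arrow argument (the projections,
  zero maps, currying, fixpoint operator) take these objects as explicit arguments.
\<close>

record ('o, 'm) category =
  Obj :: "'o set"
  Arr :: "'m set"
  Dom :: "'m \<Rightarrow> 'o"
  Cod :: "'m \<Rightarrow> 'o"
  Ident :: "'o \<Rightarrow> 'm"  ("\<one>\<index>")
  Comp :: "'m \<Rightarrow> 'm \<Rightarrow> 'm"  (infixl "\<cdot>\<index>" 70)

definition hom :: "('o, 'm, 'z) category_scheme \<Rightarrow> 'o \<Rightarrow> 'o \<Rightarrow> 'm set" where
  "hom C A B = {f \<in> Arr C. Dom C f = A \<and> Cod C f = B}"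

locale category =
  fixes C (structure)
  assumes Dom_obj: "f \<in> Arr C \<Longrightarrow> Dom C f \<in> Obj C"
    and Cod_obj: "f \<in> Arr C \<Longrightarrow> Cod C f \<in> Obj C"
    and Ident_hom: "A \<in> Obj C \<Longrightarrow> \<one> A \<in> hom C A A"
    and Comp_hom: "\<lbrakk>f \<in> hom C A B; g \<in> hom C B E\<rbrakk> \<Longrightarrow> g \<cdot> f \<in> hom C A E"
    and Comp_Ident: "f \<in> hom C A B \<Longrightarrow> f \<cdot> \<one> A = f"
    and Ident_Comp: "f \<in> hom C A B \<Longrightarrow> \<one> B \<cdot> f = f"
    and Comp_assoc: "\<lbrakk>f \<in> hom C A B; g \<in> hom C B E; h \<in> hom C E F\<rbrakk>
          \<Longrightarrow> (h \<cdot> g) \<cdot> f = h \<cdot> (g \<cdot> f)"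

record ('o, 'm) cartesian_category = "('o, 'm) category" +
  Top :: "'o"  ("\<top>\<index>")
  Bang :: "'o \<Rightarrow> 'm"
  Prod :: "'o \<Rightarrow> 'o \<Rightarrow> 'o"  (infixl "\<^bold>\<times>\<index>" 75)
  Proj1 :: "'o \<Rightarrow> 'o \<Rightarrow> 'm"
  Proj2 :: "'o \<Rightarrow> 'o \<Rightarrow> 'm"
  Pairing :: "'m \<Rightarrow> 'm \<Rightarrow> 'm"  ("\<langle>_, _\<rangle>\<index>")

locale cartesian_category = category C for C (structure) +
  assumes Top_obj: "\<top> \<in> Obj C"
    and Bang_hom: "A \<in> Obj C \<Longrightarrow> Bang C A \<in> hom C A \<top>"
    and Bang_unique: "f \<in> hom C A \<top> \<Longrightarrow> f = Bang C A"
    and Prod_obj: "\<lbrakk>A \<in> Obj C; B \<in> Obj C\<rbrakk> \<Longrightarrow> A \<^bold>\<times> B \<in> Obj C"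
    and Proj1_hom: "\<lbrakk>A \<in> Obj C; B \<in> Obj C\<rbrakk> \<Longrightarrow> Proj1 C A B \<in> hom C (A \<^bold>\<times> B) A"
    and Proj2_hom: "\<lbrakk>A \<in> Obj C; B \<in> Obj C\<rbrakk> \<Longrightarrow> Proj2 C A B \<in> hom C (A \<^bold>\<times> B) B"
    and Pairing_hom: "\<lbrakk>f \<in> hom C E A; g \<in> hom C E B\<rbrakk> \<Longrightarrow> \<langle>f, g\<rangle> \<in> hom C E (A \<^bold>\<times> B)"
    and Proj1_Pairing: "\<lbrakk>f \<in> hom C E A; g \<in> hom C E B\<rbrakk> \<Longrightarrow> Proj1 C A B \<cdot> \<langle>f, g\<rangle> = f"
    and Proj2_Pairing: "\<lbrakk>f \<in> hom C E A; g \<in> hom C E B\<rbrakk> \<Longrightarrow> Proj2 C A B \<cdot> \<langle>f, g\<rangle> = g"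
    and Pairing_unique: "\<lbrakk>A \<in> Obj C; B \<in> Obj C; h \<in> hom C E (A \<^bold>\<times> B)\<rbrakk>
          \<Longrightarrow> \<langle>Proj1 C A B \<cdot> h, Proj2 C A B \<cdot> h\<rangle> = h"

definition prod_map :: "('o, 'm, 'z) cartesian_category_scheme \<Rightarrow> 'm \<Rightarrow> 'm \<Rightarrow> 'm" where
  "prod_map C f g = \<langle>f \<cdot> Proj1 C (Dom C f) (Dom C g), g \<cdot> Proj2 C (Dom C f) (Dom C g)\<rangle>"
  for C (structure)

text \<open>The three projections from \<open>A \<times> B \<times> E\<close>.\<close>

definition triple_proj1 ::
    "('o, 'm, 'z) cartesian_category_scheme \<Rightarrow> 'o \<Rightarrow> 'o \<Rightarrow> 'o \<Rightarrow> 'm" where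
  "triple_proj1 C A B E = Proj1 C A B \<cdot> Proj1 C (A \<^bold>\<times> B) E" for C (structure)

definition triple_proj2 ::
    "('o, 'm, 'z) cartesian_category_scheme \<Rightarrow> 'o \<Rightarrow> 'o \<Rightarrow> 'o \<Rightarrow> 'm" where
  "triple_proj2 C A B E = Proj2 C A B \<cdot> Proj1 C (A \<^bold>\<times> B) E" for C (structure)

definition triple_proj3 ::
    "('o, 'm, 'z) cartesian_category_scheme \<Rightarrow> 'o \<Rightarrow> 'o \<Rightarrow> 'o \<Rightarrow> 'm" where
  "triple_proj3 C A B E = Proj2 C (A \<^bold>\<times> B) E" for C (structure)

text \<open>
  The interchange \<open>c : (A \<times> B) \<times> (E \<times> F) \<rightarrow> (A \<times> E) \<times> (B \<times> F)\<close>.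
\<close>

definition swap_middle ::
    "('o, 'm, 'z) cartesian_category_scheme \<Rightarrow> 'o \<Rightarrow> 'o \<Rightarrow> 'o \<Rightarrow> 'o \<Rightarrow> 'm" where
  "swap_middle C A B E F =
    \<langle>\<langle>Proj1 C A B \<cdot> Proj1 C (A \<^bold>\<times> B) (E \<^bold>\<times> F), Proj1 C E F \<cdot> Proj2 C (A \<^bold>\<times> B) (E \<^bold>\<times> F)\<rangle>,
     \<langle>Proj2 C A B \<cdot> Proj1 C (A \<^bold>\<times> B) (E \<^bold>\<times> F), Proj2 C E F \<cdot> Proj2 C (A \<^bold>\<times> B) (E \<^bold>\<times> F)\<rangle>\<rangle>"
  for C (structure)

record ('o, 'm) left_additive_category = "('o, 'm) cartesian_category" +
  Zero :: "'o \<Rightarrow> 'o \<Rightarrow> 'm"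
  Plus :: "'m \<Rightarrow> 'm \<Rightarrow> 'm"  (infixl "\<oplus>\<index>" 65)

text \<open>
  The record already provides room for products, but left additivity does not refer to them.
\<close>

locale left_additive_category = category C for C (structure) +
  assumes Zero_hom: "\<lbrakk>A \<in> Obj C; B \<in> Obj C\<rbrakk> \<Longrightarrow> Zero C A B \<in> hom C A B"
    and Plus_hom: "\<lbrakk>f \<in> hom C A B; g \<in> hom C A B\<rbrakk> \<Longrightarrow> f \<oplus> g \<in> hom C A B"
    and Plus_assoc: "\<lbrakk>f \<in> hom C A B; g \<in> hom C A B; h \<in> hom C A B\<rbrakk>
          \<Longrightarrow> (f \<oplus> g) \<oplus> h = f \<oplus> (g \<oplus> h)"
    and Plus_commute: "\<lbrakk>f \<in> hom C A B; g \<in> hom C A B\<rbrakk> \<Longrightarrow> f \<oplus> g = g \<oplus> f"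
    and Zero_Plus: "f \<in> hom C A B \<Longrightarrow> Zero C A B \<oplus> f = f"
    and Plus_Comp: "\<lbrakk>x \<in> hom C E A; f \<in> hom C A B; g \<in> hom C A B\<rbrakk>
          \<Longrightarrow> (f \<oplus> g) \<cdot> x = f \<cdot> x \<oplus> g \<cdot> x"
    and Zero_Comp: "\<lbrakk>x \<in> hom C E A; B \<in> Obj C\<rbrakk> \<Longrightarrow> Zero C A B \<cdot> x = Zero C E B"

definition additive :: "('o, 'm, 'z) left_additive_category_scheme \<Rightarrow> 'm \<Rightarrow> bool" where
  "additive C f \<longleftrightarrow>
    (\<forall>E \<in> Obj C.
      (\<forall>x \<in> hom C E (Dom C f). \<forall>y \<in> hom C E (Dom C f). f \<cdot> (x \<oplus> y) = f \<cdot> x \<oplus> f \<cdot> y) \<and>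
      f \<cdot> Zero C E (Dom C f) = Zero C E (Cod C f))"
  for C (structure)

locale cartesian_left_additive_category =
  cartesian_category C + left_additive_category C for C (structure) +
  assumes Proj1_additive: "\<lbrakk>A \<in> Obj C; B \<in> Obj C\<rbrakk> \<Longrightarrow> additive C (Proj1 C A B)"
    and Proj2_additive: "\<lbrakk>A \<in> Obj C; B \<in> Obj C\<rbrakk> \<Longrightarrow> additive C (Proj2 C A B)"

record ('o, 'm) differential_category = "('o, 'm) left_additive_category" +
  Diff :: "'m \<Rightarrow> 'm"  ("\<^bold>D\<index>")

locale cartesian_differential_category = cartesian_left_additive_category C for C (structure) +
  assumes Diff_hom: "f \<in> hom C A B \<Longrightarrow> \<^bold>D f \<in> hom C (A \<^bold>\<times> A) B"
    and CD1_Zero: "\<lbrakk>A \<in> Obj C; B \<in> Obj C\<rbrakk> \<Longrightarrow> \<^bold>D (Zero C A B) = Zero C (A \<^bold>\<times> A) B"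
    and CD1_Plus: "\<lbrakk>f \<in> hom C A B; g \<in> hom C A B\<rbrakk> \<Longrightarrow> \<^bold>D (f \<oplus> g) = \<^bold>D f \<oplus> \<^bold>D g"
    and CD2_Zero: "\<lbrakk>f \<in> hom C A B; x \<in> hom C E A\<rbrakk> \<Longrightarrow> \<^bold>D f \<cdot> \<langle>x, Zero C E A\<rangle> = Zero C E B"
    and CD2_Plus: "\<lbrakk>f \<in> hom C A B; x \<in> hom C E A; y \<in> hom C E A; z \<in> hom C E A\<rbrakk>
          \<Longrightarrow> \<^bold>D f \<cdot> \<langle>x, y \<oplus> z\<rangle> = \<^bold>D f \<cdot> \<langle>x, y\<rangle> \<oplus> \<^bold>D f \<cdot> \<langle>x, z\<rangle>"
    and CD3_Ident: "A \<in> Obj C \<Longrightarrow> \<^bold>D (\<one> A) = Proj2 C A A"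
    and CD3_Proj1: "\<lbrakk>A \<in> Obj C; B \<in> Obj C\<rbrakk>
          \<Longrightarrow> \<^bold>D (Proj1 C A B) = Proj1 C A B \<cdot> Proj2 C (A \<^bold>\<times> B) (A \<^bold>\<times> B)"
    and CD3_Proj2: "\<lbrakk>A \<in> Obj C; B \<in> Obj C\<rbrakk>
          \<Longrightarrow> \<^bold>D (Proj2 C A B) = Proj2 C A B \<cdot> Proj2 C (A \<^bold>\<times> B) (A \<^bold>\<times> B)"
    and CD4: "\<lbrakk>f \<in> hom C E A; g \<in> hom C E B\<rbrakk> \<Longrightarrow> \<^bold>D \<langle>f, g\<rangle> = \<langle>\<^bold>D f, \<^bold>D g\<rangle>"
    and CD5: "\<lbrakk>f \<in> hom C A B; g \<in> hom C B E\<rbrakk>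
          \<Longrightarrow> \<^bold>D (g \<cdot> f) = \<^bold>D g \<cdot> \<langle>f \<cdot> Proj1 C A A, \<^bold>D f\<rangle>"
    and CD6: "\<lbrakk>f \<in> hom C A B; x \<in> hom C E A; y \<in> hom C E A; z \<in> hom C E A\<rbrakk>
          \<Longrightarrow> \<^bold>D (\<^bold>D f) \<cdot> \<langle>\<langle>x, y\<rangle>, \<langle>Zero C E A, z\<rangle>\<rangle> = \<^bold>D f \<cdot> \<langle>x, z\<rangle>"
    and CD7: "\<lbrakk>f \<in> hom C A B; x \<in> hom C E A; y \<in> hom C E A; z \<in> hom C E A\<rbrakk>
          \<Longrightarrow> \<^bold>D (\<^bold>D f) \<cdot> \<langle>\<langle>x, y\<rangle>, \<langle>z, Zero C E A\<rangle>\<rangle> = \<^bold>D (\<^bold>D f) \<cdot> \<langle>\<langle>x, z\<rangle>, \<langle>y, Zero C E A\<rangle>\<rangle>"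

text \<open>The tangent bundle functor, on objects and on maps.\<close>

definition tangent_obj :: "('o, 'm, 'z) differential_category_scheme \<Rightarrow> 'o \<Rightarrow> 'o" where
  "tangent_obj C A = A \<^bold>\<times> A" for C (structure)

definition tangent_map :: "('o, 'm, 'z) differential_category_scheme \<Rightarrow> 'm \<Rightarrow> 'm" where
  "tangent_map C f = \<langle>f \<cdot> Proj1 C (Dom C f) (Dom C f), \<^bold>D f\<rangle>" for C (structure)

record ('o, 'm) closed_differential_category = "('o, 'm) differential_category" +
  Exp :: "'o \<Rightarrow> 'o \<Rightarrow> 'o"  (infixr "\<^bold>\<Rightarrow>\<index>" 74)
  Eval :: "'o \<Rightarrow> 'o \<Rightarrow> 'm"
  Curry :: "'o \<Rightarrow> 'o \<Rightarrow> 'm \<Rightarrow> 'm"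

text \<open>
  \<open>Curry C E A f\<close> is the currying \<open>E \<rightarrow> (A \<Rightarrow> B)\<close> of \<open>f : E \<times> A \<rightarrow> B\<close>.
\<close>

locale cartesian_closed_category = cartesian_category C for C (structure) +
  assumes Exp_obj: "\<lbrakk>A \<in> Obj C; B \<in> Obj C\<rbrakk> \<Longrightarrow> (A \<^bold>\<Rightarrow> B) \<in> Obj C"
    and Eval_hom: "\<lbrakk>A \<in> Obj C; B \<in> Obj C\<rbrakk> \<Longrightarrow> Eval C A B \<in> hom C ((A \<^bold>\<Rightarrow> B) \<^bold>\<times> A) B"
    and Curry_hom: "\<lbrakk>E \<in> Obj C; A \<in> Obj C; f \<in> hom C (E \<^bold>\<times> A) B\<rbrakk>
          \<Longrightarrow> Curry C E A f \<in> hom C E (A \<^bold>\<Rightarrow> B)"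
    and Eval_Curry: "\<lbrakk>E \<in> Obj C; A \<in> Obj C; f \<in> hom C (E \<^bold>\<times> A) B\<rbrakk>
          \<Longrightarrow> Eval C A B \<cdot> prod_map C (Curry C E A f) (\<one> A) = f"
    and Curry_unique: "\<lbrakk>E \<in> Obj C; A \<in> Obj C; B \<in> Obj C; f \<in> hom C (E \<^bold>\<times> A) B;
          h \<in> hom C E (A \<^bold>\<Rightarrow> B); Eval C A B \<cdot> prod_map C h (\<one> A) = f\<rbrakk> \<Longrightarrow> h = Curry C E A f"

locale cartesian_closed_differential_category =
  cartesian_differential_category C + cartesian_closed_category C for C (structure) +
  assumes Eval_linear: "\<lbrakk>A \<in> Obj C; B \<in> Obj C; g \<in> hom C E (A \<^bold>\<Rightarrow> B); h \<in> hom C E (A \<^bold>\<Rightarrow> B);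
          a \<in> hom C E A\<rbrakk>
          \<Longrightarrow> \<^bold>D (Eval C A B) \<cdot> \<langle>\<langle>g, a\<rangle>, \<langle>h, Zero C E A\<rangle>\<rangle> = Eval C A B \<cdot> \<langle>h, a\<rangle>"

text \<open>\<open>Fix A X f : A \<rightarrow> X\<close> is the parametrized fixpoint of \<open>f : A \<times> X \<rightarrow> X\<close>.\<close>

locale parametrized_fixpoint_operator = cartesian_category C for C (structure) +
  fixes Fix
  assumes Fix_hom: "\<lbrakk>A \<in> Obj C; X \<in> Obj C; f \<in> hom C (A \<^bold>\<times> X) X\<rbrakk> \<Longrightarrow> Fix A X f \<in> hom C A X"
    and Fix_fixpoint: "\<lbrakk>A \<in> Obj C; X \<in> Obj C; f \<in> hom C (A \<^bold>\<times> X) X\<rbrakk>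
          \<Longrightarrow> f \<cdot> \<langle>\<one> A, Fix A X f\<rangle> = Fix A X f"
    and Fix_natural: "\<lbrakk>B \<in> Obj C; X \<in> Obj C; g \<in> hom C A B; f \<in> hom C (B \<^bold>\<times> X) X\<rbrakk>
          \<Longrightarrow> Fix B X f \<cdot> g = Fix A X (f \<cdot> prod_map C g (\<one> X))"

definition differential_fixpoint_rule ::
    "('o, 'm, 'z) differential_category_scheme \<Rightarrow> ('o \<Rightarrow> 'o \<Rightarrow> 'm \<Rightarrow> 'm) \<Rightarrow> bool" where
  "differential_fixpoint_rule C Fix \<longleftrightarrow>
    (\<forall>A \<in> Obj C. \<forall>X \<in> Obj C. \<forall>f \<in> hom C (A \<^bold>\<times> X) X.
      \<^bold>D (Fix A X f) =
        Proj2 C X X \<cdot>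
          Fix (tangent_obj C A) (tangent_obj C X) (tangent_map C f \<cdot> swap_middle C A A X X))"
  for C (structure)

definition tangent_fixpoint_rule ::
    "('o, 'm, 'z) differential_category_scheme \<Rightarrow> ('o \<Rightarrow> 'o \<Rightarrow> 'm \<Rightarrow> 'm) \<Rightarrow> bool" where
  "tangent_fixpoint_rule C Fix \<longleftrightarrow>
    (\<forall>A \<in> Obj C. \<forall>X \<in> Obj C. \<forall>f \<in> hom C (A \<^bold>\<times> X) X.
      tangent_map C (Fix A X f) =
        Fix (tangent_obj C A) (tangent_obj C X) (tangent_map C f \<cdot> swap_middle C A A X X))"
  for C (structure)

definition strong_differential_fixpoint_rule ::
    "('o, 'm, 'z) differential_category_scheme \<Rightarrow> ('o \<Rightarrow> 'o \<Rightarrow> 'm \<Rightarrow> 'm) \<Rightarrow> bool" where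
  "strong_differential_fixpoint_rule C Fix \<longleftrightarrow>
    (\<forall>A \<in> Obj C. \<forall>X \<in> Obj C. \<forall>f \<in> hom C (A \<^bold>\<times> X) X.
      \<^bold>D (Fix A X f) =
        Fix (A \<^bold>\<times> A) X
          (\<^bold>D f \<cdot> \<langle>\<langle>triple_proj1 C A A X, Fix A X f \<cdot> triple_proj1 C A A X\<rangle>,
                  \<langle>triple_proj2 C A A X, triple_proj3 C A A X\<rangle>\<rangle>))"
  for C (structure)

definition Y_comb ::
    "('o, 'm, 'z) closed_differential_category_scheme \<Rightarrow> ('o \<Rightarrow> 'o \<Rightarrow> 'm \<Rightarrow> 'm) \<Rightarrow> 'o \<Rightarrow> 'm" where
  "Y_comb C Fix X = Fix (X \<^bold>\<Rightarrow> X) X (Eval C X X)" for C (structure)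

end

theory Submission
  imports Defs
begin

text \<open>
  Every map \<open>f : A \<times> X \<rightarrow> X\<close> is a substitution instance of evaluation, namely
  \<open>f = eval \<circ> (\<lambda>(f) \<times> 1)\<close>. Hence a property of such maps that is stable under substitution in the
  parameter, i.e. under passing from \<open>f\<close> to \<open>f \<circ> (h \<times> 1)\<close>, holds for all of them as soon as it
  holds for the evaluations (\<open>stable_iff_Eval\<close>).

  Each of the three rules is stable in this sense. Its left-hand side is \<open>D[fix f]\<close> or
  \<open>T(fix f)\<close>; as \<open>fix (f \<circ> (h \<times> 1)) = fix f \<circ> h\<close>, the chain rule says that substituting \<open>h\<close>
  in \<open>f\<close> composes this side with \<open>T(h)\<close>. The right-hand side is, up to composition with \<open>\<pi>\<^sub>2\<close>
  in the differential rule, a fixpoint with parameters in \<open>T(A)\<close>, so by naturality composing it with \<open>T(h)\<close> substitutes \<open>T(h)\<close> in its body, and a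
  computation with \<open>D[h \<times> 1]\<close> shows that this turns the body built from \<open>f\<close> into the one built
  from \<open>f \<circ> (h \<times> 1)\<close> (\<open>Fix_tangent_substitution\<close>, \<open>Fix_strong_substitution\<close>).

  So each rule is equivalent to its instance at \<open>eval\<close>, whose fixpoint is \<open>Y\<close>, and
  the identity \<open>fix g = Y \<circ> \<lambda>(g)\<close> (\<open>Fix_eq_Y_comb\<close>) puts the right-hand side of this instance
  in the stated form.
\<close>

section \<open>Equational reasoning with arrows\<close>

text \<open>
  The laws of a category, restated with side conditions on the domain and codomain functions: the
  intermediate objects of a composite are then determined by its factors, so that the laws can be
  used as conditional rewrite rules.
\<close>

lemma in_hom_iff: "f \<in> hom C A B \<longleftrightarrow> f \<in> Arr C \<and> Dom C f = A \<and> Cod C f = B"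
  by (simp add: hom_def)

context category
begin

lemma Ident_simps [simp]:
  assumes "A \<in> Obj C"
  shows "\<one> A \<in> Arr C" "Dom C (\<one> A) = A" "Cod C (\<one> A) = A"
  using Ident_hom[OF assms] by (auto simp: in_hom_iff)

lemma Comp_simps [simp]:
  assumes "f \<in> Arr C" "g \<in> Arr C" "Cod C f = Dom C g"
  shows "g \<cdot> f \<in> Arr C" "Dom C (g \<cdot> f) = Dom C f" "Cod C (g \<cdot> f) = Cod C g"
  using Comp_hom[of f "Dom C f" "Dom C g" g "Cod C g"] assms by (auto simp: in_hom_iff)

lemma Comp_Ident_simp [simp]: "\<lbrakk>f \<in> Arr C; Dom C f = A\<rbrakk> \<Longrightarrow> f \<cdot> \<one> A = f"
  by (rule Comp_Ident) (auto simp: in_hom_iff)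

lemma Ident_Comp_simp [simp]: "\<lbrakk>f \<in> Arr C; Cod C f = B\<rbrakk> \<Longrightarrow> \<one> B \<cdot> f = f"
  by (rule Ident_Comp) (auto simp: in_hom_iff)

lemma Comp_assoc_simp [simp]:
  "\<lbrakk>f \<in> Arr C; g \<in> Arr C; h \<in> Arr C; Cod C f = Dom C g; Cod C g = Dom C h\<rbrakk>
    \<Longrightarrow> (h \<cdot> g) \<cdot> f = h \<cdot> (g \<cdot> f)"
  by (rule Comp_assoc) (auto simp: in_hom_iff)

declare Dom_obj [simp] Cod_obj [simp]

end

context cartesian_category
begin

declare Prod_obj [simp]

lemma Proj1_simps [simp]:
  assumes "A \<in> Obj C" "B \<in> Obj C"
  shows "Proj1 C A B \<in> Arr C" "Dom C (Proj1 C A B) = A \<^bold>\<times> B" "Cod C (Proj1 C A B) = A"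
  using Proj1_hom[OF assms] by (auto simp: in_hom_iff)

lemma Proj2_simps [simp]:
  assumes "A \<in> Obj C" "B \<in> Obj C"
  shows "Proj2 C A B \<in> Arr C" "Dom C (Proj2 C A B) = A \<^bold>\<times> B" "Cod C (Proj2 C A B) = B"
  using Proj2_hom[OF assms] by (auto simp: in_hom_iff)

lemma Pairing_simps [simp]:
  assumes "f \<in> Arr C" "g \<in> Arr C" "Dom C f = Dom C g"
  shows "\<langle>f, g\<rangle> \<in> Arr C" "Dom C \<langle>f, g\<rangle> = Dom C g" "Cod C \<langle>f, g\<rangle> = Cod C f \<^bold>\<times> Cod C g"
  using Pairing_hom[of f "Dom C g" "Cod C f" g "Cod C g"] assms by (auto simp: in_hom_iff)

lemma Proj1_Pairing_simp [simp]:
  "\<lbrakk>f \<in> Arr C; g \<in> Arr C; Dom C f = Dom C g; Cod C f = A; Cod C g = B\<rbrakk>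
    \<Longrightarrow> Proj1 C A B \<cdot> \<langle>f, g\<rangle> = f"
  by (rule Proj1_Pairing) (auto simp: in_hom_iff)

lemma Proj2_Pairing_simp [simp]:
  "\<lbrakk>f \<in> Arr C; g \<in> Arr C; Dom C f = Dom C g; Cod C f = A; Cod C g = B\<rbrakk>
    \<Longrightarrow> Proj2 C A B \<cdot> \<langle>f, g\<rangle> = g"
  by (rule Proj2_Pairing) (auto simp: in_hom_iff)

lemma Pairing_Comp [simp]:
  assumes "f \<in> Arr C" "g \<in> Arr C" "Dom C f = Dom C g" "h \<in> Arr C" "Cod C h = Dom C g"
  shows "\<langle>f, g\<rangle> \<cdot> h = \<langle>f \<cdot> h, g \<cdot> h\<rangle>"
proof -
  let ?A = "Cod C f" and ?B = "Cod C g"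
  have "Proj1 C ?A ?B \<cdot> (\<langle>f, g\<rangle> \<cdot> h) = f \<cdot> h" "Proj2 C ?A ?B \<cdot> (\<langle>f, g\<rangle> \<cdot> h) = g \<cdot> h"
    using assms by (simp_all flip: Comp_assoc_simp)
  with Pairing_unique[of ?A ?B "\<langle>f, g\<rangle> \<cdot> h" "Dom C h"] assms show ?thesis
    by (simp add: in_hom_iff)
qed

lemma Pairing_Proj_Comp [simp]:
  "\<lbrakk>A \<in> Obj C; B \<in> Obj C; h \<in> Arr C; Cod C h = A \<^bold>\<times> B\<rbrakk>
    \<Longrightarrow> \<langle>Proj1 C A B \<cdot> h, Proj2 C A B \<cdot> h\<rangle> = h"
  by (rule Pairing_unique) (auto simp: in_hom_iff)

lemma prod_map_hom:
  "\<lbrakk>f \<in> hom C A B; g \<in> hom C E F\<rbrakk> \<Longrightarrow> prod_map C f g \<in> hom C (A \<^bold>\<times> E) (B \<^bold>\<times> F)"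
  by (auto simp: prod_map_def in_hom_iff)

lemma swap_middle_hom:
  "\<lbrakk>A \<in> Obj C; B \<in> Obj C; E \<in> Obj C; F \<in> Obj C\<rbrakk>
    \<Longrightarrow> swap_middle C A B E F \<in> hom C ((A \<^bold>\<times> B) \<^bold>\<times> (E \<^bold>\<times> F)) ((A \<^bold>\<times> E) \<^bold>\<times> (B \<^bold>\<times> F))"
  by (auto simp: swap_middle_def in_hom_iff)

end

section \<open>The chain rule and the tangent functor\<close>

context cartesian_differential_category
begin

lemma Diff_simps [simp]:
  assumes "f \<in> Arr C"
  shows "\<^bold>D f \<in> Arr C" "Dom C (\<^bold>D f) = Dom C f \<^bold>\<times> Dom C f" "Cod C (\<^bold>D f) = Cod C f"
  using Diff_hom[of f "Dom C f" "Cod C f"] assms by (auto simp: in_hom_iff)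

lemma Diff_Comp:
  "\<lbrakk>f \<in> hom C A B; g \<in> hom C B E\<rbrakk> \<Longrightarrow> \<^bold>D (g \<cdot> f) = \<^bold>D g \<cdot> tangent_map C f"
  using CD5[of f A B g E] by (simp add: tangent_map_def in_hom_iff)

lemma tangent_map_hom:
  "f \<in> hom C A B \<Longrightarrow> tangent_map C f \<in> hom C (tangent_obj C A) (tangent_obj C B)"
  by (auto simp: tangent_map_def tangent_obj_def in_hom_iff)

lemma tangent_map_Comp:
  "\<lbrakk>f \<in> hom C A B; g \<in> hom C B E\<rbrakk>
    \<Longrightarrow> tangent_map C (g \<cdot> f) = tangent_map C g \<cdot> tangent_map C f"
  using Diff_Comp[of f A B g E] by (auto simp: tangent_map_def in_hom_iff)

lemma Diff_prod_map_Ident: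
  assumes "h \<in> hom C B A" "X \<in> Obj C"
  shows "\<^bold>D (prod_map C h (\<one> X)) =
    \<langle>\<^bold>D h \<cdot> \<langle>Proj1 C B X \<cdot> Proj1 C (B \<^bold>\<times> X) (B \<^bold>\<times> X), Proj1 C B X \<cdot> Proj2 C (B \<^bold>\<times> X) (B \<^bold>\<times> X)\<rangle>,
     Proj2 C B X \<cdot> Proj2 C (B \<^bold>\<times> X) (B \<^bold>\<times> X)\<rangle>"
proof -
  have B: "B \<in> Obj C" using assms by (auto simp: in_hom_iff)
  have "\<^bold>D \<langle>h \<cdot> Proj1 C B X, Proj2 C B X\<rangle> = \<langle>\<^bold>D (h \<cdot> Proj1 C B X), \<^bold>D (Proj2 C B X)\<rangle>"
    by (rule CD4[where E = "B \<^bold>\<times> X" and A = A and B = X])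
      (use assms B in \<open>auto simp: in_hom_iff\<close>)
  moreover have "\<^bold>D (h \<cdot> Proj1 C B X) = \<^bold>D h \<cdot> tangent_map C (Proj1 C B X)"
    by (rule Diff_Comp[where A = "B \<^bold>\<times> X" and B = B and E = A])
      (use assms B in \<open>auto simp: in_hom_iff\<close>)
  ultimately show ?thesis
    using assms B by (auto simp: prod_map_def tangent_map_def in_hom_iff CD3_Proj1 CD3_Proj2)
qed

text \<open>
  Differentiation acts componentwise on \<open>h \<times> 1\<close>, so \<open>T(h \<times> 1)\<close> agrees with
  \<open>T(h) \<times> T(1) = T(h) \<times> 1\<close> up to the order of the four factors, which \<open>c\<close> exchanges.
\<close>

lemma tangent_map_prod_map_swap_middle:
  assumes "h \<in> hom C B A" "X \<in> Obj C"
  shows "tangent_map C (prod_map C h (\<one> X)) \<cdot> swap_middle C B B X X =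
    swap_middle C A A X X \<cdot> prod_map C (tangent_map C h) (\<one> (tangent_obj C X))"
proof -
  have obj: "A \<in> Obj C" "B \<in> Obj C" using assms by (auto simp: in_hom_iff)
  show ?thesis
    unfolding tangent_map_def[of _ "prod_map C h (\<one> X)"] Diff_prod_map_Ident[OF assms]
    using assms obj
    by (auto simp: prod_map_def tangent_map_def tangent_obj_def swap_middle_def in_hom_iff)
qed

end

section \<open>Fixpoints under substitution\<close>

locale differential_category_with_fixpoints =
  cartesian_differential_category C + parametrized_fixpoint_operator C Fix
  for C (structure) and Fix
begin

text \<open>
  The fixpoint on the right-hand side of the tangent-fixpoint rule, and the map whose fixpoint is
  the right-hand side of the strong differential-fixpoint rule.
\<close>

definition tangent_fix where
  "tangent_fix A X f =
    Fix (tangent_obj C A) (tangent_obj C X) (tangent_map C f \<cdot> swap_middle C A A X X)"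

definition strong_body where
  "strong_body A X f = \<^bold>D f \<cdot> \<langle>\<langle>triple_proj1 C A A X, Fix A X f \<cdot> triple_proj1 C A A X\<rangle>,
    \<langle>triple_proj2 C A A X, triple_proj3 C A A X\<rangle>\<rangle>"

lemma tangent_body_hom:
  assumes "A \<in> Obj C" "X \<in> Obj C" "f \<in> hom C (A \<^bold>\<times> X) X"
  shows "tangent_map C f \<cdot> swap_middle C A A X X
    \<in> hom C (tangent_obj C A \<^bold>\<times> tangent_obj C X) (tangent_obj C X)"
  using tangent_map_hom[OF assms(3)] swap_middle_hom[of A A X X] assms(1,2)
  by (auto intro: Comp_hom simp: tangent_obj_def)

lemma tangent_fix_hom:
  "\<lbrakk>A \<in> Obj C; X \<in> Obj C; f \<in> hom C (A \<^bold>\<times> X) X\<rbrakk>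
    \<Longrightarrow> tangent_fix A X f \<in> hom C (tangent_obj C A) (tangent_obj C X)"
  unfolding tangent_fix_def
  by (rule Fix_hom[OF _ _ tangent_body_hom]) (auto simp: tangent_obj_def)

lemma strong_body_hom:
  assumes "A \<in> Obj C" "X \<in> Obj C" "f \<in> hom C (A \<^bold>\<times> X) X"
  shows "strong_body A X f \<in> hom C (A \<^bold>\<times> A \<^bold>\<times> X) X"
  using Fix_hom[OF assms] assms
  by (auto simp: strong_body_def in_hom_iff triple_proj1_def triple_proj2_def triple_proj3_def)

text \<open>
  Naturality moves \<open>T(h)\<close> into the body \<open>T(f) \<circ> c\<close> as \<open>T(h) \<times> 1\<close>; past \<open>c\<close> it becomes
  \<open>T(h \<times> 1)\<close>, which functoriality of \<open>T\<close> absorbs into \<open>T(f)\<close>.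
\<close>

lemma Fix_tangent_substitution:
  assumes "X \<in> Obj C" "h \<in> hom C B A" "f \<in> hom C (A \<^bold>\<times> X) X"
  shows "tangent_fix A X f \<cdot> tangent_map C h = tangent_fix B X (f \<cdot> prod_map C h (\<one> X))"
proof -
  have obj: "A \<in> Obj C" "B \<in> Obj C" "tangent_obj C A \<in> Obj C" "tangent_obj C X \<in> Obj C"
    using assms by (auto simp: in_hom_iff tangent_obj_def)
  let ?h = "prod_map C h (\<one> X)" and ?Th = "prod_map C (tangent_map C h) (\<one> (tangent_obj C X))"
  note hh = prod_map_hom[OF assms(2) Ident_hom[OF assms(1)]]
  note Th = prod_map_hom[OF tangent_map_hom[OF assms(2)] Ident_hom[OF obj(4)]]
  have "(tangent_map C f \<cdot> swap_middle C A A X X) \<cdot> ?Th =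
      tangent_map C f \<cdot> (swap_middle C A A X X \<cdot> ?Th)"
    using Th tangent_map_hom[OF assms(3)] swap_middle_hom[of A A X X] obj assms(1)
    by (simp add: in_hom_iff tangent_obj_def)
  also have "\<dots> = tangent_map C f \<cdot> (tangent_map C ?h \<cdot> swap_middle C B B X X)"
    by (simp add: tangent_map_prod_map_swap_middle[OF assms(2,1)])
  also have "\<dots> = tangent_map C (f \<cdot> ?h) \<cdot> swap_middle C B B X X"
    using tangent_map_Comp[OF hh assms(3)] tangent_map_hom[OF assms(3)] tangent_map_hom[OF hh]
      swap_middle_hom[of B B X X] obj assms(1)
    by (simp add: in_hom_iff tangent_obj_def)
  finally show ?thesis
    unfolding tangent_fix_def
    using Fix_natural[OF obj(3,4) tangent_map_hom[OF assms(2)]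
        tangent_body_hom[OF obj(1) assms(1,3)]]
    by simp
qed

text \<open>
  Both sides differentiate \<open>f\<close> at a point built from \<open>h\<close> and in a direction built from \<open>D[h]\<close>.
  The second component \<open>fix f \<circ> \<pi>\<^sub>1\<close> of the tuple in the strong rule also depends on \<open>f\<close>; naturality
  of the fixpoint operator turns it into the corresponding component for \<open>f \<circ> (h \<times> 1)\<close>.
\<close>

lemma Fix_strong_substitution:
  assumes "X \<in> Obj C" "h \<in> hom C B A" "f \<in> hom C (A \<^bold>\<times> X) X"
  shows "Fix (A \<^bold>\<times> A) X (strong_body A X f) \<cdot> tangent_map C h =
    Fix (B \<^bold>\<times> B) X (strong_body B X (f \<cdot> prod_map C h (\<one> X)))"
proof -
  have obj: "A \<in> Obj C" "B \<in> Obj C" using assms by (auto simp: in_hom_iff)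
  let ?h = "prod_map C h (\<one> X)"
  note hh = prod_map_hom[OF assms(2) Ident_hom[OF assms(1)]]
  note F = Fix_hom[OF obj(1) assms(1,3)]
  have "strong_body A X f \<cdot> prod_map C (tangent_map C h) (\<one> X) = strong_body B X (f \<cdot> ?h)"
    unfolding strong_body_def Diff_Comp[OF hh assms(3)]
      tangent_map_def[of _ "prod_map C h (\<one> X)"] Diff_prod_map_Ident[OF assms(2,1)]
      Fix_natural[OF obj(1) assms(1,2,3), symmetric]
    using assms obj F
    by (auto simp: prod_map_def tangent_map_def in_hom_iff
        triple_proj1_def triple_proj2_def triple_proj3_def)
  then show ?thesis
    using Fix_natural[OF _ assms(1) tangent_map_hom[OF assms(2), unfolded tangent_obj_def]
        strong_body_hom[OF obj(1) assms(1,3)]] obj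
    by simp
qed

lemma Diff_Fix_substitution:
  assumes "X \<in> Obj C" "h \<in> hom C B A" "f \<in> hom C (A \<^bold>\<times> X) X"
  shows "\<^bold>D (Fix B X (f \<cdot> prod_map C h (\<one> X))) = \<^bold>D (Fix A X f) \<cdot> tangent_map C h"
    and "tangent_map C (Fix B X (f \<cdot> prod_map C h (\<one> X))) =
      tangent_map C (Fix A X f) \<cdot> tangent_map C h"
proof -
  have A: "A \<in> Obj C" using assms by (auto simp: in_hom_iff)
  note F = Fix_hom[OF A assms(1,3)]
  show "\<^bold>D (Fix B X (f \<cdot> prod_map C h (\<one> X))) = \<^bold>D (Fix A X f) \<cdot> tangent_map C h"
    using Diff_Comp[OF assms(2) F] by (simp only: Fix_natural[OF A assms])
  show "tangent_map C (Fix B X (f \<cdot> prod_map C h (\<one> X))) =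
      tangent_map C (Fix A X f) \<cdot> tangent_map C h"
    using tangent_map_Comp[OF assms(2) F] by (simp only: Fix_natural[OF A assms])
qed

end

section \<open>Reduction to evaluation\<close>

context cartesian_closed_category
begin

text \<open>
  For the converse, stability is applied to the evaluation and \<open>h = \<lambda>(f)\<close>, since
  \<open>eval \<circ> (\<lambda>(f) \<times> 1) = f\<close>.
\<close>

lemma stable_iff_Eval:
  assumes "\<And>A B X f h. \<lbrakk>X \<in> Obj C; h \<in> hom C B A; f \<in> hom C (A \<^bold>\<times> X) X; P A X f\<rbrakk>
    \<Longrightarrow> P B X (f \<cdot> prod_map C h (\<one> X))"
  shows "(\<forall>A \<in> Obj C. \<forall>X \<in> Obj C. \<forall>f \<in> hom C (A \<^bold>\<times> X) X. P A X f) \<longleftrightarrow>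
    (\<forall>X \<in> Obj C. P (X \<^bold>\<Rightarrow> X) X (Eval C X X))"
proof (intro iffI ballI)
  fix A X f
  assume "\<forall>X \<in> Obj C. P (X \<^bold>\<Rightarrow> X) X (Eval C X X)"
    and A: "A \<in> Obj C" and X: "X \<in> Obj C" and f: "f \<in> hom C (A \<^bold>\<times> X) X"
  then have "P A X (Eval C X X \<cdot> prod_map C (Curry C A X f) (\<one> X))"
    using assms[OF X Curry_hom[OF A X f] Eval_hom[OF X X]] by blast
  then show "P A X f"
    using Eval_Curry[OF A X f] by simp
qed (use Exp_obj Eval_hom in blast)

end

text \<open>This is naturality in \<open>\<lambda>(g)\<close>, since \<open>eval \<circ> (\<lambda>(g) \<times> 1) = g\<close>.\<close>

lemma Fix_eq_Y_comb:
  fixes C (structure)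
  assumes "cartesian_closed_category C" "parametrized_fixpoint_operator C Fix"
    and "A \<in> Obj C" "X \<in> Obj C" "g \<in> hom C (A \<^bold>\<times> X) X"
  shows "Y_comb C Fix X \<cdot> Curry C A X g = Fix A X g"
proof -
  interpret cartesian_closed_category C by fact
  interpret parametrized_fixpoint_operator C Fix by fact
  show ?thesis
    unfolding Y_comb_def
    using Fix_natural[OF Exp_obj assms(4) Curry_hom[OF assms(3-5)] Eval_hom] assms(3-5)
    by (simp add: Eval_Curry)
qed

theorem proposition6p2:
  fixes C :: "('o, 'm, 'z) closed_differential_category_scheme" (structure)
    and Fix :: "'o \<Rightarrow> 'o \<Rightarrow> 'm \<Rightarrow> 'm"
  assumes "cartesian_closed_differential_category C"
    and "parametrized_fixpoint_operator C Fix"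
  shows "(differential_fixpoint_rule C Fix \<longleftrightarrow>
      (\<forall>X \<in> Obj C.
        \<^bold>D (Y_comb C Fix X) =
          Proj2 C X X \<cdot> Y_comb C Fix (tangent_obj C X) \<cdot>
            Curry C (tangent_obj C (X \<^bold>\<Rightarrow> X)) (tangent_obj C X)
              (tangent_map C (Eval C X X) \<cdot> swap_middle C (X \<^bold>\<Rightarrow> X) (X \<^bold>\<Rightarrow> X) X X)))
    \<and> (tangent_fixpoint_rule C Fix \<longleftrightarrow>
      (\<forall>X \<in> Obj C.
        tangent_map C (Y_comb C Fix X) =
          Y_comb C Fix (tangent_obj C X) \<cdot>
            Curry C (tangent_obj C (X \<^bold>\<Rightarrow> X)) (tangent_obj C X)
              (tangent_map C (Eval C X X) \<cdot> swap_middle C (X \<^bold>\<Rightarrow> X) (X \<^bold>\<Rightarrow> X) X X)))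
    \<and> (strong_differential_fixpoint_rule C Fix \<longleftrightarrow>
      (\<forall>X \<in> Obj C.
        \<^bold>D (Y_comb C Fix X) =
          Y_comb C Fix X \<cdot>
            Curry C ((X \<^bold>\<Rightarrow> X) \<^bold>\<times> (X \<^bold>\<Rightarrow> X)) X
              (\<^bold>D (Eval C X X) \<cdot>
                \<langle>\<langle>triple_proj1 C (X \<^bold>\<Rightarrow> X) (X \<^bold>\<Rightarrow> X) X,
                  Y_comb C Fix X \<cdot> triple_proj1 C (X \<^bold>\<Rightarrow> X) (X \<^bold>\<Rightarrow> X) X\<rangle>,
                 \<langle>triple_proj2 C (X \<^bold>\<Rightarrow> X) (X \<^bold>\<Rightarrow> X) X,
                  triple_proj3 C (X \<^bold>\<Rightarrow> X) (X \<^bold>\<Rightarrow> X) X\<rangle>\<rangle>)))"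
proof -
  interpret cartesian_closed_differential_category C by fact
  interpret parametrized_fixpoint_operator C Fix by fact
  interpret differential_category_with_fixpoints C Fix ..
  note Y = Fix_eq_Y_comb[OF cartesian_closed_category_axioms assms(2)]

  have 1: "differential_fixpoint_rule C Fix \<longleftrightarrow> (\<forall>X \<in> Obj C.
      \<^bold>D (Y_comb C Fix X) = Proj2 C X X \<cdot> tangent_fix (X \<^bold>\<Rightarrow> X) X (Eval C X X))"
    unfolding differential_fixpoint_rule_def tangent_fix_def[symmetric] Y_comb_def
  proof (rule stable_iff_Eval)
    fix A B X f h
    assume a: "X \<in> Obj C" "h \<in> hom C B A" "f \<in> hom C (A \<^bold>\<times> X) X"
      and rule: "\<^bold>D (Fix A X f) = Proj2 C X X \<cdot> tangent_fix A X f"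
    have A: "A \<in> Obj C" using a by (auto simp: in_hom_iff)
    have "\<^bold>D (Fix B X (f \<cdot> prod_map C h (\<one> X))) =
        Proj2 C X X \<cdot> tangent_fix A X f \<cdot> tangent_map C h"
      by (simp only: Diff_Fix_substitution[OF a] rule)
    also have "\<dots> = Proj2 C X X \<cdot> (tangent_fix A X f \<cdot> tangent_map C h)"
      using Comp_assoc[OF tangent_map_hom[OF a(2)] tangent_fix_hom[OF A a(1,3)]
          Proj2_hom[OF a(1,1), folded tangent_obj_def]] .
    finally show "\<^bold>D (Fix B X (f \<cdot> prod_map C h (\<one> X))) =
        Proj2 C X X \<cdot> tangent_fix B X (f \<cdot> prod_map C h (\<one> X))"
      by (simp only: Fix_tangent_substitution[OF a])
  qed
  have 2: "tangent_fixpoint_rule C Fix \<longleftrightarrow> (\<forall>X \<in> Obj C.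
      tangent_map C (Y_comb C Fix X) = tangent_fix (X \<^bold>\<Rightarrow> X) X (Eval C X X))"
    unfolding tangent_fixpoint_rule_def tangent_fix_def[symmetric] Y_comb_def
    by (rule stable_iff_Eval) (simp only: Diff_Fix_substitution Fix_tangent_substitution)
  have 3: "strong_differential_fixpoint_rule C Fix \<longleftrightarrow> (\<forall>X \<in> Obj C.
      \<^bold>D (Y_comb C Fix X) =
        Fix ((X \<^bold>\<Rightarrow> X) \<^bold>\<times> (X \<^bold>\<Rightarrow> X)) X (strong_body (X \<^bold>\<Rightarrow> X) X (Eval C X X)))"
    unfolding strong_differential_fixpoint_rule_def strong_body_def[symmetric] Y_comb_def
    by (rule stable_iff_Eval) (simp only: Diff_Fix_substitution Fix_strong_substitution)

  have tangent: "Y_comb C Fix (tangent_obj C X) \<cdot>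
      Curry C (tangent_obj C (X \<^bold>\<Rightarrow> X)) (tangent_obj C X)
        (tangent_map C (Eval C X X) \<cdot> swap_middle C (X \<^bold>\<Rightarrow> X) (X \<^bold>\<Rightarrow> X) X X) =
      tangent_fix (X \<^bold>\<Rightarrow> X) X (Eval C X X)" if X: "X \<in> Obj C" for X
    unfolding tangent_fix_def
    by (rule Y) (use X Exp_obj tangent_body_hom Eval_hom in \<open>auto simp: tangent_obj_def\<close>)
  have Proj2_tangent: "Proj2 C X X \<cdot> Y_comb C Fix (tangent_obj C X) \<cdot>
      Curry C (tangent_obj C (X \<^bold>\<Rightarrow> X)) (tangent_obj C X)
        (tangent_map C (Eval C X X) \<cdot> swap_middle C (X \<^bold>\<Rightarrow> X) (X \<^bold>\<Rightarrow> X) X X) =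
      Proj2 C X X \<cdot> tangent_fix (X \<^bold>\<Rightarrow> X) X (Eval C X X)" if X: "X \<in> Obj C" for X
  proof -
    have obj: "tangent_obj C X \<in> Obj C" "tangent_obj C (X \<^bold>\<Rightarrow> X) \<in> Obj C" "(X \<^bold>\<Rightarrow> X) \<in> Obj C"
      using X Exp_obj by (auto simp: tangent_obj_def)
    have "Y_comb C Fix (tangent_obj C X)
        \<in> hom C (tangent_obj C X \<^bold>\<Rightarrow> tangent_obj C X) (tangent_obj C X)"
      unfolding Y_comb_def using obj Exp_obj Eval_hom Fix_hom by blast
    moreover note Curry_hom[OF obj(2,1) tangent_body_hom[OF obj(3) X Eval_hom[OF X X]]]
    ultimately show ?thesis
      using tangent[OF X] Comp_assoc[OF _ _ Proj2_hom[OF X X]]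
      by (simp add: tangent_obj_def)
  qed
  have strong: "Y_comb C Fix X \<cdot> Curry C ((X \<^bold>\<Rightarrow> X) \<^bold>\<times> (X \<^bold>\<Rightarrow> X)) X
      (strong_body (X \<^bold>\<Rightarrow> X) X (Eval C X X)) =
      Fix ((X \<^bold>\<Rightarrow> X) \<^bold>\<times> (X \<^bold>\<Rightarrow> X)) X (strong_body (X \<^bold>\<Rightarrow> X) X (Eval C X X))"
    if X: "X \<in> Obj C" for X
    by (rule Y) (use X Exp_obj strong_body_hom Eval_hom in auto)
  have strong_body_Eval: "strong_body (X \<^bold>\<Rightarrow> X) X (Eval C X X) =
      \<^bold>D (Eval C X X) \<cdot>
        \<langle>\<langle>triple_proj1 C (X \<^bold>\<Rightarrow> X) (X \<^bold>\<Rightarrow> X) X,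
          Y_comb C Fix X \<cdot> triple_proj1 C (X \<^bold>\<Rightarrow> X) (X \<^bold>\<Rightarrow> X) X\<rangle>,
         \<langle>triple_proj2 C (X \<^bold>\<Rightarrow> X) (X \<^bold>\<Rightarrow> X) X,
          triple_proj3 C (X \<^bold>\<Rightarrow> X) (X \<^bold>\<Rightarrow> X) X\<rangle>\<rangle>" for X
    by (simp only: strong_body_def Y_comb_def)
  show ?thesis
    unfolding 1 2 3 strong_body_Eval[symmetric]
    by (simp only: tangent Proj2_tangent strong cong: ball_cong)
qed

end
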